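(* Let $n$, $r$ and $d_2,\dots,d_r$ be integers such that $r\ge 3$ and $1<d_2<\dots<d_r\le n/2$. (i) There does not exist any identifying code $C$ in $C_n(1,d_2,\dots,d_r)$ such that $|C|=n/(r+1)$. (ii) There does not exist any self-identifying code $C$ in $C_n(1,d_2,\dots,d_r)$ such that $|C|=n/r$.
   Context: All graphs are simple and undirected. For a graph $G=(V,E)$ and $u\in V$, $N[u]=\{u\}\cup\{v: uv\in E\}$. A code is a nonempty $C\subseteq V$, and $I(C;u)=N[u]\cap C$. $C$ is dominating if $I(C;u)\neq\emptyset$ for all $u$; identifying if dominating and $I(C;u)\neq I(C;v)$ for all distinct $u,v\in V$; self-identifying if $I(C;u)\setminus I(C;v)\neq\emptyset$ for all distinct $u,v\in V$. For positive integers $n$ and $d_1,\dots,d_k\le n/2$, the circulant graph $C_n(d_1,\dots,d_k)$ has vertex set $\mathbb{Z}_n$, and the open neighbourhood of $u$ is $\{u\pm d_1,\dots,u\pm d_k\}$ modulo $n$. *)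

theory Defs
  imports Complex_Main "Graph_Theory.Pair_Digraph"
begin

text \<open>A simple undirected graph is a loop-free digraph with a symmetric set of arcs
  (\<^locale>\<open>pair_graph\<close>).\<close>

definition closed_nbhd :: "'a pair_pre_digraph \<Rightarrow> 'a \<Rightarrow> 'a set"
  where "closed_nbhd G u = {u} \<union> {v. u \<rightarrow>\<^bsub>G\<^esub> v}"

definition is_code :: "'a pair_pre_digraph \<Rightarrow> 'a set \<Rightarrow> bool"
  where "is_code G C \<longleftrightarrow> C \<noteq> {} \<and> C \<subseteq> pverts G"

definition iset :: "'a pair_pre_digraph \<Rightarrow> 'a set \<Rightarrow> 'a \<Rightarrow> 'a set"
  where "iset G C u = closed_nbhd G u \<inter> C"

definition dominating_code :: "'a pair_pre_digraph \<Rightarrow> 'a set \<Rightarrow> bool"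
  where "dominating_code G C \<longleftrightarrow> is_code G C \<and> (\<forall>u\<in>pverts G. iset G C u \<noteq> {})"

definition identifying_code :: "'a pair_pre_digraph \<Rightarrow> 'a set \<Rightarrow> bool"
  where "identifying_code G C \<longleftrightarrow> dominating_code G C \<and>
    (\<forall>u\<in>pverts G. \<forall>v\<in>pverts G. u \<noteq> v \<longrightarrow> iset G C u \<noteq> iset G C v)"

definition self_identifying_code :: "'a pair_pre_digraph \<Rightarrow> 'a set \<Rightarrow> bool"
  where "self_identifying_code G C \<longleftrightarrow> is_code G C \<and>
    (\<forall>u\<in>pverts G. \<forall>v\<in>pverts G. u \<noteq> v \<longrightarrow> iset G C u - iset G C v \<noteq> {})"

text \<open>The residues modulo \<open>n\<close> are represented by \<open>{0..<n}\<close>; \<open>D\<close> is the set of the connection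
  parameters, which are meant to lie between \<open>1\<close> and \<open>n/2\<close>.\<close>

definition circulant_graph :: "int \<Rightarrow> int set \<Rightarrow> int pair_pre_digraph"
  where "circulant_graph n D =
    \<lparr>pverts = {0..<n},
     parcs = {(u, v). u \<in> {0..<n} \<and> (\<exists>d\<in>D. v = (u + d) mod n \<or> v = (u - d) mod n)}\<rparr>"

lemma pair_graph_circulant_graph:
  assumes "0 < n" and "\<forall>d\<in>D. 1 \<le> d \<and> 2 * d \<le> n"
  shows "pair_graph (circulant_graph n D)"
proof -
  let ?G = "circulant_graph n D"
  have sub: "parcs ?G \<subseteq> {0..<n} \<times> {0..<n}"
    using assms(1) by (auto simp: circulant_graph_def)
  have sym: "(v, u) \<in> parcs ?G" if "(u, v) \<in> parcs ?G" for u v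
  proof -
    from that obtain d where u: "0 \<le> u" "u < n" and d: "d \<in> D"
      and v: "v = (u + d) mod n \<or> v = (u - d) mod n"
      by (auto simp: circulant_graph_def)
    have "u = (v - d) mod n \<or> u = (v + d) mod n"
      using v u by (auto simp: mod_simps)
    with d v assms(1) show ?thesis
      by (auto simp: circulant_graph_def)
  qed
  have loop: "(u, u) \<notin> parcs ?G" for u
  proof
    assume "(u, u) \<in> parcs ?G"
    then obtain d where u: "0 \<le> u" "u < n" and d: "d \<in> D"
      and e: "u = (u + d) mod n \<or> u = (u - d) mod n"
      by (auto simp: circulant_graph_def)
    have "u mod n = (u + d) mod n \<or> u mod n = (u - d) mod n"
      using e u by auto
    then have "n dvd d"
      by (auto simp: mod_eq_dvd_iff)
    moreover have "0 < d" "d < n"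
      using assms d by fastforce+
    ultimately show False
      using zdvd_not_zless by blast
  qed
  show ?thesis
  proof
    show "finite (pverts ?G)"
      by (simp add: circulant_graph_def)
    show "finite (parcs ?G)"
      using sub by (rule finite_subset) simp
    show "symmetric ?G"
      using sym by (auto simp: symmetric_def intro: symI)
    show "fst e \<noteq> snd e" if "e \<in> parcs ?G" for e
      using that loop by (metis prod.collapse)
  qed (use sub in \<open>auto simp: circulant_graph_def\<close>)
qed

end

theory Submission
  imports Defs
begin

text \<open>
  Double counting gives \<open>(\<Sum>u. |I(u)|) \<le> (2r+1) |C|\<close>. An identifying code has at most \<open>|C|\<close>
  singletons among its sets \<open>I(u)\<close>; for a self-identifying code \<open>|I(u)| \<ge> 2\<close>, and \<open>|I(u)| \<ge> 3\<close>
  if \<open>u \<in> C\<close>. At the two critical cardinalities these estimates are tight, so \<open>|I(u)| \<le> 2\<close> for all \<open>u\<close>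
  in the first case and \<open>|I(u)| = 2\<close> for all \<open>u \<notin> C\<close> in the second. If \<open>I(u) = {c, c'}\<close>, then the
  reflection \<open>x \<mapsto> c + c' - x\<close> preserves \<open>N[c] \<inter> N[c']\<close>, and since \<open>u\<close> is identified it is a fixed point,
  that is \<open>c' = 2u - c\<close>. For \<open>u = c + 1\<close> this shows that \<open>c \<in> C\<close> implies \<open>c + 1 \<in> C\<close> or
  \<open>c + 2 \<in> C\<close>. Hence \<open>C \<union> (C + 1)\<close> is everything and \<open>n \<le> 2 |C|\<close>, which is too large.
\<close>

section \<open>Closed neighbourhoods in circulant graphs\<close>

lemma closed_nbhd_circulant_eq:
  assumes "u \<in> {0..<n}"
  shows "closed_nbhd (circulant_graph n D) u = (\<lambda>s. (u + s) mod n) ` insert 0 (D \<union> uminus ` D)"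
  using assms by (auto simp: closed_nbhd_def circulant_graph_def image_Un image_image)

lemma mem_closed_nbhd_circulant_iff:
  assumes "u \<in> {0..<n}" "v \<in> {0..<n}"
  shows "v \<in> closed_nbhd (circulant_graph n D) u \<longleftrightarrow>
    (\<exists>s\<in>insert 0 (D \<union> uminus ` D). n dvd v - u - s)"
proof -
  have "v = (u + s) mod n \<longleftrightarrow> n dvd v - u - s" for s
    using assms(2) mod_eq_dvd_iff[of v n "u + s"] by (simp add: diff_diff_eq)
  then show ?thesis
    by (simp only: closed_nbhd_circulant_eq[OF assms(1)] image_iff)
qed

lemma closed_nbhd_circulant_sym:
  assumes "u \<in> {0..<n}" "v \<in> {0..<n}" "v \<in> closed_nbhd (circulant_graph n D) u"
  shows "u \<in> closed_nbhd (circulant_graph n D) v"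
proof -
  obtain s where s: "s \<in> insert 0 (D \<union> uminus ` D)" "n dvd v - u - s"
    using assms by (auto simp only: mem_closed_nbhd_circulant_iff)
  have "u - v - - s = - (v - u - s)"
    by simp
  then have "n dvd u - v - - s"
    using s(2) by (simp only: dvd_minus_iff)
  moreover have "- s \<in> insert 0 (D \<union> uminus ` D)"
    using s(1) by auto
  ultimately show ?thesis
    unfolding mem_closed_nbhd_circulant_iff[OF assms(2,1)] by blast
qed

text \<open>The reflection sending \<open>x\<close> to \<open>c + c' - x\<close> modulo
  \<open>n\<close> swaps \<open>c\<close> and \<open>c'\<close>. It preserves adjacency because the
  set of offsets is closed under negation.\<close>

lemma closed_nbhd_circulant_reflect:
  assumes "u \<in> {0..<n}" "c \<in> {0..<n}" "c' \<in> {0..<n}"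
    and "c' \<in> closed_nbhd (circulant_graph n D) u"
  shows "c \<in> closed_nbhd (circulant_graph n D) ((c + c' - u) mod n)"
proof -
  let ?w = "(c + c' - u) mod n"
  have w: "?w \<in> {0..<n}"
    using assms(1) by auto
  have "u \<in> closed_nbhd (circulant_graph n D) c'"
    using assms closed_nbhd_circulant_sym by blast
  then obtain s where s: "s \<in> insert 0 (D \<union> uminus ` D)" "n dvd u - c' - s"
    using assms by (auto simp only: mem_closed_nbhd_circulant_iff)
  have "n dvd (c + c' - u) - ?w"
    by (simp add: minus_mod_eq_mult_div)
  then have "n dvd (u - c' - s) + ((c + c' - u) - ?w)"
    using s(2) by (rule dvd_add[rotated])
  also have "(u - c' - s) + ((c + c' - u) - ?w) = c - ?w - s"
    by simp
  finally show ?thesis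
    unfolding mem_closed_nbhd_circulant_iff[OF w assms(2)] using s(1) by blast
qed

text \<open>Only an inequality holds: an offset and its negative coincide modulo \<open>n\<close>,
  for instance, when twice the offset is \<open>n\<close>.\<close>

lemma card_closed_nbhd_circulant_le:
  assumes "u \<in> {0..<n}" "finite D"
  shows "card (closed_nbhd (circulant_graph n D) u) \<le> 2 * card D + 1"
proof -
  have "card (closed_nbhd (circulant_graph n D) u) \<le> card (insert 0 (D \<union> uminus ` D))"
    unfolding closed_nbhd_circulant_eq[OF assms(1)] using assms(2) by (intro card_image_le) auto
  also have "\<dots> \<le> Suc (card (D \<union> uminus ` D))"
    using assms(2) by (simp add: card_insert_if)
  also have "\<dots> \<le> Suc (card D + card (uminus ` D))"
    using card_Un_le by auto
  also have "\<dots> \<le> 2 * card D + 1"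
    using card_image_le[OF assms(2), of uminus] by simp
  finally show ?thesis .
qed

text \<open>Counting pairs by codeword instead of by vertex: by symmetry, \<open>c\<close> is
  counted only for vertices \<open>u\<close> in its own closed neighbourhood.\<close>

lemma sum_card_iset_circulant_le:
  assumes "C \<subseteq> {0..<n}" "finite D"
  shows "(\<Sum>u\<in>{0..<n}. card (iset (circulant_graph n D) C u)) \<le> (2 * card D + 1) * card C"
proof -
  let ?N = "closed_nbhd (circulant_graph n D)"
  have fin: "finite C"
    using assms(1) finite_subset by blast
  have "(\<Sum>u\<in>{0..<n}. card (iset (circulant_graph n D) C u)) =
      (\<Sum>u\<in>{0..<n}. card {c \<in> C. c \<in> ?N u})"
    by (intro sum.cong arg_cong[of _ _ card]) (auto simp: iset_def)
  also have "\<dots> = (\<Sum>c\<in>C. card {u \<in> {0..<n}. c \<in> ?N u})"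
    using fin by (intro sum_multicount_gen) auto
  also have "\<dots> \<le> (\<Sum>c\<in>C. 2 * card D + 1)"
  proof (rule sum_mono)
    fix c assume c: "c \<in> C"
    have "{u \<in> {0..<n}. c \<in> ?N u} \<subseteq> ?N c"
      using c assms(1) closed_nbhd_circulant_sym by blast
    moreover have "finite (?N c)"
      using closed_nbhd_circulant_eq[of c n D] c assms by auto
    ultimately have "card {u \<in> {0..<n}. c \<in> ?N u} \<le> card (?N c)"
      by (rule card_mono[rotated])
    also have "\<dots> \<le> 2 * card D + 1"
      using c assms by (intro card_closed_nbhd_circulant_le) auto
    finally show "card {u \<in> {0..<n}. c \<in> ?N u} \<le> 2 * card D + 1" .
  qed
  finally show ?thesis
    by (simp add: mult.commute)
qed

section \<open>Gaps between codewords\<close>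

text \<open>The reflection swapping \<open>c\<close> and \<open>c'\<close> sends
  \<open>c + 1\<close> to a vertex that also sees both of them, hence to itself. Solving
  \<open>c + c' - (c + 1) = c + 1\<close> for \<open>c'\<close> involves no division by 2, so the
  parity of \<open>n\<close> is irrelevant.\<close>

lemma eq_add_two_if_iset_pair:
  assumes "c \<in> {0..<n}" "c' \<in> {0..<n}"
    and I: "iset (circulant_graph n D) C ((c + 1) mod n) = {c, c'}"
    and unique: "\<And>w. w \<in> {0..<n} \<Longrightarrow> {c, c'} \<subseteq> iset (circulant_graph n D) C w \<Longrightarrow> w = (c + 1) mod n"
  shows "c' = (c + 2) mod n"
proof -
  let ?u = "(c + 1) mod n" and ?N = "closed_nbhd (circulant_graph n D)"
  have u: "?u \<in> {0..<n}"
    using assms(1) by auto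
  have C: "c \<in> C" "c' \<in> C" and N: "c \<in> ?N ?u" "c' \<in> ?N ?u"
    using I by (auto simp: iset_def)
  let ?w = "(c + c' - ?u) mod n"
  have "c \<in> ?N ?w"
    using closed_nbhd_circulant_reflect[OF u assms(1,2) N(2)] .
  moreover have "c' \<in> ?N ?w"
    using closed_nbhd_circulant_reflect[OF u assms(2,1) N(1)] by (simp add: add.commute)
  ultimately have "?w = ?u"
    using C assms(1) by (intro unique) (auto simp: iset_def)
  then have "(c + c' - (c + 1)) mod n = (c + 1) mod n"
    by (simp add: mod_diff_right_eq)
  then have "n dvd c' - (c + 2)"
    by (simp add: mod_eq_dvd_iff algebra_simps)
  then show ?thesis
    using assms(2) mod_eq_dvd_iff[of c' n "c + 2"] by simp
qed

text \<open>The union of \<open>C\<close> and its shift by 1 is nonempty and closed under adding 1,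
  so it contains all residues.\<close>

lemma two_card_ge_if_small_gaps:
  fixes n :: int
  assumes sub: "C \<subseteq> {0..<n}" and ne: "C \<noteq> {}"
    and step: "\<And>c. c \<in> C \<Longrightarrow> (c + 1) mod n \<in> C \<or> (c + 2) mod n \<in> C"
  shows "n \<le> 2 * int (card C)"
proof -
  let ?E = "C \<union> (\<lambda>c. (c + 1) mod n) ` C"
  have E: "(x + 1) mod n \<in> ?E" if "x \<in> ?E" for x
    using that
  proof
    assume "x \<in> (\<lambda>c. (c + 1) mod n) ` C"
    then obtain c where c: "c \<in> C" "x = (c + 1) mod n"
      by blast
    then have "(x + 1) mod n = (c + 2) mod n"
      by (simp add: mod_add_left_eq add.assoc)
    \<comment> \<open>If \<open>step\<close> yields \<open>c + 1\<close> in \<open>C\<close> instead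
      of \<open>c + 2\<close>, then \<open>c + 2\<close> is the shift of the codeword
      \<open>c + 1\<close>.\<close>
    moreover have "(c + 2) mod n \<in> ?E"
      using step[OF c(1)] \<open>(x + 1) mod n = (c + 2) mod n\<close> c(2) by (metis Un_iff image_eqI)
    ultimately show ?thesis
      by simp
  qed auto
  obtain a where a: "a \<in> C"
    using ne by blast
  have orbit: "(a + int k) mod n \<in> ?E" for k
  proof (induction k)
    case 0
    then show ?case
      using a sub by auto
  next
    case (Suc k)
    then have "((a + int k) mod n + 1) mod n \<in> ?E"
      by (rule E)
    moreover have "((a + int k) mod n + 1) mod n = (a + int (Suc k)) mod n"
      by (simp add: mod_add_left_eq add.assoc add.commute[of "int k"])
    ultimately show ?case
      by simp
  qed
  have "{0..<n} \<subseteq> ?E"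
  proof
    fix x assume x: "x \<in> {0..<n}"
    \<comment> \<open>The summand \<open>n\<close> makes the number of steps from \<open>a\<close>
      to \<open>x\<close> nonnegative.\<close>
    define k where "k = nat (x - a + n)"
    have "int k = x - a + n"
      using x a sub by (force simp: k_def)
    then have "(a + int k) mod n = x"
      using x by simp
    then show "x \<in> ?E"
      using orbit[of k] by simp
  qed
  have fin: "finite C"
    using sub finite_subset by blast
  have "card {0..<n} \<le> card ?E"
    using \<open>{0..<n} \<subseteq> ?E\<close> fin by (intro card_mono) auto
  also have "\<dots> \<le> card C + card ((\<lambda>c. (c + 1) mod n) ` C)"
    by (rule card_Un_le)
  also have "\<dots> \<le> card C + card C"
    using card_image_le[OF fin] by simp
  finally show ?thesis
    by simp
qed

section \<open>Codes of critical cardinality\<close>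

lemma identifying_code_small_gaps:
  assumes n: "n > 1" and D: "finite D" "1 \<in> D"
    and ident: "identifying_code (circulant_graph n D) C"
    and card: "n = (int (card D) + 1) * int (card C)"
    and c: "c \<in> C"
  shows "(c + 2) mod n \<in> C"
proof -
  let ?G = "circulant_graph n D"
  let ?I = "iset ?G C"
  let ?V = "{0..<n}"
  have V: "pverts ?G = ?V"
    by (simp add: circulant_graph_def)
  have sub: "C \<subseteq> ?V" and dom: "\<And>u. u \<in> ?V \<Longrightarrow> ?I u \<noteq> {}"
    and inj: "\<And>u v. u \<in> ?V \<Longrightarrow> v \<in> ?V \<Longrightarrow> ?I u = ?I v \<Longrightarrow> u = v"
    using ident unfolding identifying_code_def dominating_code_def is_code_def V by blast+
  have fin: "finite C"
    using sub finite_subset by blast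
  have finI: "finite (?I u)" for u
    using fin by (simp add: iset_def)
  define S where "S = {u \<in> ?V. card (?I u) = 1}"
  have "card S = card (?I ` S)"
    by (rule card_image[symmetric]) (auto simp: inj_on_def S_def intro: inj)
  also have "\<dots> \<le> card ((\<lambda>x. {x}) ` C)"
    using fin by (intro card_mono) (auto simp: S_def card_1_singleton_iff iset_def)
  also have "\<dots> \<le> card C"
    by (rule card_image_le[OF fin])
  finally have S: "card S \<le> card C" .
  \<comment> \<open>The excess \<open>f\<close> is nonnegative by domination. With
    \<open>r = card D\<close>, its sum is at most \<open>(2r+1)|C| - 2(r+1)|C| + |C| = 0\<close>, so
    it vanishes everywhere, which excludes sets of three or more codewords.\<close>
  define f where "f u = int (card (?I u)) - 2 + of_bool (card (?I u) = 1)" for u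
  have "sum f ?V = int (\<Sum>u\<in>?V. card (?I u)) - 2 * n + (\<Sum>u\<in>?V. of_bool (card (?I u) = 1))"
    using n by (simp add: f_def sum.distrib sum_subtractf)
  also have "(\<Sum>u\<in>?V. of_bool (card (?I u) = 1)) = int (card S)"
    by (simp add: S_def Int_def)
  finally have "sum f ?V \<le> int ((2 * card D + 1) * card C) - 2 * n + int (card C)"
    using S sum_card_iset_circulant_le[OF sub D(1)] by linarith
  also have "\<dots> = 0"
    using card by (simp add: algebra_simps)
  finally have sum_le: "sum f ?V \<le> 0" .
  have f_ge: "f u \<ge> 0" if "u \<in> ?V" for u
  proof -
    have "card (?I u) > 0"
      using dom[OF that] finI by (simp add: card_gt_0_iff)
    then show ?thesis
      by (auto simp: f_def)
  qed
  have "\<forall>u\<in>?V. f u = 0"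
    using sum_le f_ge sum_nonneg_eq_0_iff[of ?V f] sum_nonneg[of ?V f] by fastforce
  then have le2: "card (?I u) \<le> 2" if "u \<in> ?V" for u
    using that by (fastforce simp: f_def of_bool_def split: if_splits)
  have pair: "?I u = {x, y}" if "u \<in> ?V" "x \<noteq> y" "{x, y} \<subseteq> ?I u" for u x y
    using le2[OF that(1)] card_seteq[OF finI that(3)] that(2) by simp
  have cV: "c \<in> ?V"
    using c sub by blast
  have self: "x \<in> closed_nbhd ?G x" for x
    by (simp add: closed_nbhd_def)
  \<comment> \<open>A codeword \<open>c'\<close> adjacent to \<open>c\<close> would make
    \<open>{c, c'}\<close> the set of both vertices. So codewords are pairwise nonadjacent, and
    \<open>c + 1\<close> must see a second codeword to be distinguished from
    \<open>c\<close>.\<close>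
  have Ic: "?I c = {c}"
  proof (rule ccontr)
    assume "?I c \<noteq> {c}"
    moreover have "c \<in> ?I c"
      using c self by (simp add: iset_def)
    ultimately obtain c' where c': "c' \<in> ?I c" "c' \<noteq> c"
      by blast
    then have c'V: "c' \<in> C" "c' \<in> ?V"
      using sub by (auto simp: iset_def)
    have "c \<in> ?I c'"
      using c' c c'V cV closed_nbhd_circulant_sym[of c n c' D] by (auto simp: iset_def)
    then have "?I c' = {c, c'}"
      using c' c'V self by (intro pair) (auto simp: iset_def)
    moreover have "?I c = {c, c'}"
      using c' c cV self by (intro pair) (auto simp: iset_def)
    ultimately show False
      using inj[OF cV c'V(2)] c' by simp
  qed
  let ?u = "(c + 1) mod n"
  have u: "?u \<in> ?V"
    using n by simp
  have ne: "?u \<noteq> c"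
    using cV n mod_eq_dvd_iff[of "c + 1" n c] zdvd_not_zless[of 1 n] by auto
  have "?u \<in> closed_nbhd ?G c"
    unfolding closed_nbhd_circulant_eq[OF cV] using D by blast
  then have cu: "c \<in> ?I ?u"
    using closed_nbhd_circulant_sym[OF cV u] c by (simp add: iset_def)
  moreover have "?I ?u \<noteq> {c}"
    using inj[OF u cV] ne Ic by auto
  ultimately obtain c' where c': "c' \<in> ?I ?u" "c' \<noteq> c"
    by blast
  then have c'C: "c' \<in> C"
    by (simp add: iset_def)
  have Iu: "?I ?u = {c, c'}"
    using c' cu u by (intro pair) auto
  have "c' = (c + 2) mod n"
  proof (rule eq_add_two_if_iset_pair[OF cV _ Iu])
    show "w = ?u" if "w \<in> ?V" "{c, c'} \<subseteq> ?I w" for w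
      using pair[OF that(1) _ that(2)] Iu c'(2) inj[OF that(1) u] by auto
  qed (use c'C sub in blast)
  then show ?thesis
    using c'C by simp
qed

lemma self_identifying_code_small_gaps:
  assumes n: "n > 1" and D: "finite D" "1 \<in> D"
    and ident: "self_identifying_code (circulant_graph n D) C"
    and card: "n = int (card D) * int (card C)"
    and c: "c \<in> C"
  shows "(c + 1) mod n \<in> C \<or> (c + 2) mod n \<in> C"
proof (rule disjCI)
  let ?G = "circulant_graph n D"
  let ?I = "iset ?G C"
  let ?V = "{0..<n}"
  have V: "pverts ?G = ?V"
    by (simp add: circulant_graph_def)
  have sub: "C \<subseteq> ?V"
    and ident': "\<And>u v. u \<in> ?V \<Longrightarrow> v \<in> ?V \<Longrightarrow> ?I u \<subseteq> ?I v \<Longrightarrow> u = v"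
    using ident unfolding self_identifying_code_def is_code_def V by blast+
  have fin: "finite C"
    using sub finite_subset by blast
  have finI: "finite (?I u)" for u
    using fin by (simp add: iset_def)
  have self: "x \<in> closed_nbhd ?G x" for x
    by (simp add: closed_nbhd_def)
  have succ: "(x + 1) mod n \<in> ?V" "(x + 1) mod n \<noteq> x" "x \<in> closed_nbhd ?G ((x + 1) mod n)"
    if x: "x \<in> ?V" for x
  proof -
    show u: "(x + 1) mod n \<in> ?V"
      using n by simp
    show "(x + 1) mod n \<noteq> x"
      using x n mod_eq_dvd_iff[of "x + 1" n x] zdvd_not_zless[of 1 n] by auto
    have "(x + 1) mod n \<in> closed_nbhd ?G x"
      unfolding closed_nbhd_circulant_eq[OF x] using D by blast
    then show "x \<in> closed_nbhd ?G ((x + 1) mod n)"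
      using closed_nbhd_circulant_sym[OF x u] by simp
  qed
  \<comment> \<open>Such a set would be contained in those of both \<open>x\<close> and
    \<open>x + 1\<close>, which are distinct vertices. The empty set is covered too.\<close>
  have not_single: "\<not> ?I u \<subseteq> {x}" if u: "u \<in> ?V" and x: "x \<in> C" for u x
  proof
    assume I: "?I u \<subseteq> {x}"
    have xV: "x \<in> ?V"
      using x sub by blast
    have "?I u \<subseteq> ?I x"
      using I x self by (auto simp: iset_def)
    moreover have "?I u \<subseteq> ?I ((x + 1) mod n)"
      using I x succ(3)[OF xV] by (auto simp: iset_def)
    ultimately show False
      using ident'[OF u xV] ident'[OF u succ(1)[OF xV]] succ(2)[OF xV] by simp
  qed
  have ge2: "card (?I u) \<ge> 2" if u: "u \<in> ?V" for u
  proof -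
    obtain x where x: "x \<in> ?I u"
      using not_single[OF u c] by blast
    then obtain y where "y \<in> ?I u" "y \<noteq> x"
      using not_single[OF u, of x] by (auto simp: iset_def)
    with x have "card {x, y} \<le> card (?I u)"
      by (intro card_mono finI) auto
    with \<open>y \<noteq> x\<close> show ?thesis
      by simp
  qed
  \<comment> \<open>A codeword \<open>u\<close> seeing just one other codeword \<open>y\<close>
    would have its set contained in that of \<open>y\<close>.\<close>
  have ge3: "card (?I u) \<ge> 3" if u: "u \<in> C" for u
  proof (rule ccontr)
    have uV: "u \<in> ?V"
      using u sub by blast
    assume "\<not> card (?I u) \<ge> 3"
    then have c2: "card (?I u) = 2"
      using ge2[OF uV] by simp
    have "u \<in> ?I u"
      using u self by (simp add: iset_def)
    with c2 obtain y where y: "?I u = {u, y}" "y \<noteq> u"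
      by (auto simp: card_2_iff doubleton_eq_iff)
    then have yC: "y \<in> C" "y \<in> closed_nbhd ?G u" "y \<in> ?V"
      using sub by (auto simp: iset_def)
    then have "?I u \<subseteq> ?I y"
      using y u self closed_nbhd_circulant_sym[OF uV] by (auto simp: iset_def)
    then show False
      using ident'[OF uV yC(3)] y by simp
  qed
  \<comment> \<open>This is the excess over the lower bounds 2 and, on \<open>C\<close>, 3. With
    \<open>r = card D\<close>, its sum is at most \<open>(2r+1)|C| - 2r|C| - |C| = 0\<close>, so
    both bounds are attained everywhere.\<close>
  define f where "f u = int (card (?I u)) - 2 - of_bool (u \<in> C)" for u
  have "sum f ?V = int (\<Sum>u\<in>?V. card (?I u)) - 2 * n - (\<Sum>u\<in>?V. of_bool (u \<in> C))"
    using n by (simp add: f_def sum_subtractf)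
  also have "(\<Sum>u\<in>?V. of_bool (u \<in> C)) = int (card C)"
    using sub by (simp add: Int_absorb1)
  finally have "sum f ?V \<le> int ((2 * card D + 1) * card C) - 2 * n - int (card C)"
    using sum_card_iset_circulant_le[OF sub D(1)] by linarith
  also have "\<dots> = 0"
    using card by (simp add: algebra_simps)
  finally have sum_le: "sum f ?V \<le> 0" .
  have f_ge: "f u \<ge> 0" if "u \<in> ?V" for u
    using ge2[OF that] ge3[of u] by (cases "u \<in> C") (auto simp: f_def)
  have f0: "\<forall>u\<in>?V. f u = 0"
    using sum_le f_ge sum_nonneg_eq_0_iff[of ?V f] sum_nonneg[of ?V f] by fastforce
  let ?u = "(c + 1) mod n"
  have cV: "c \<in> ?V"
    using c sub by blast
  note u = succ(1)[OF cV]
  show "(c + 1) mod n \<in> C" if "(c + 2) mod n \<notin> C"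
  proof (rule ccontr)
    assume "(c + 1) mod n \<notin> C"
    then have "card (?I ?u) = 2"
      using bspec[OF f0 u] by (simp add: f_def)
    moreover have "c \<in> ?I ?u"
      using c succ(3)[OF cV] by (simp add: iset_def)
    ultimately obtain c' where Iu: "?I ?u = {c, c'}"
      by (auto simp: card_2_iff doubleton_eq_iff)
    then have c'C: "c' \<in> C"
      by (auto simp: iset_def)
    have "c' = (c + 2) mod n"
    proof (rule eq_add_two_if_iset_pair[OF cV _ Iu])
      \<comment> \<open>Uniqueness is self-identification itself: the set of \<open>c + 1\<close> is
        contained in that of no other vertex.\<close>
      show "w = ?u" if "w \<in> ?V" "{c, c'} \<subseteq> ?I w" for w
        using ident'[OF u that(1)] Iu that(2) by simp
    qed (use c'C sub in blast)
    then show False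
      using c'C that by simp
  qed
qed

section \<open>Contradiction with the critical cardinalities\<close>

theorem theorem12:
  fixes n :: int and r :: nat and d :: "nat \<Rightarrow> int"
  assumes "r \<ge> 3"
    and "1 < d 2"
    and "\<And>i. 2 \<le> i \<Longrightarrow> i < r \<Longrightarrow> d i < d (i + 1)"
    and "real_of_int (d r) \<le> real_of_int n / 2"
  shows "(\<nexists>C. identifying_code (circulant_graph n ({1} \<union> d ` {2..r})) C \<and>
               real (card C) = real_of_int n / (real r + 1))
       \<and> (\<nexists>C. self_identifying_code (circulant_graph n ({1} \<union> d ` {2..r})) C \<and>
               real (card C) = real_of_int n / real r)"
proof -
  let ?D = "{1} \<union> d ` {2..r}"
  have less: "d i < d j" if "2 \<le> i" "i < j" "j \<le> r" for i j
    using that(2,3)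
  proof (induction j)
    case (Suc j)
    then show ?case
      using assms(3)[of j] that(1) by (cases "i = j") auto
  qed simp
  have gt1: "1 < d i" if "i \<in> {2..r}" for i
    using that less[of 2 i] assms(2) by (cases "i = 2") auto
  have "card (d ` {2..r}) = r - 1"
    using less by (subst card_image) (auto intro!: linorder_inj_onI simp: less_imp_neq)
  moreover have "1 \<notin> d ` {2..r}"
    using gt1 by force
  ultimately have cardD: "card ?D = r"
    using assms(1) by simp
  have D: "finite ?D" "1 \<in> ?D"
    by auto
  have n: "n > 1"
    using gt1[of r] assms(1,4) by simp
  have V: "pverts (circulant_graph n ?D) = {0..<n}"
    by (simp add: circulant_graph_def)
  have False if C: "identifying_code (circulant_graph n ?D) C"
    and card: "real (card C) = real_of_int n / (real r + 1)" for C
  proof -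
    have "real_of_int n = real_of_int ((int r + 1) * int (card C))"
      using card by (simp add: field_simps)
    then have nC: "n = (int r + 1) * int (card C)"
      by (simp only: of_int_eq_iff)
    have sub: "C \<subseteq> {0..<n}" "C \<noteq> {}"
      using C V by (auto simp: identifying_code_def dominating_code_def is_code_def)
    have "n \<le> 2 * int (card C)"
      using identifying_code_small_gaps[OF n D C] nC cardD
      by (intro two_card_ge_if_small_gaps[OF sub]) simp
    \<comment> \<open>Now \<open>4|C| \<le> n \<le> 2|C|\<close> forces
      \<open>n \<le> 0\<close>.\<close>
    moreover have "4 * int (card C) \<le> (int r + 1) * int (card C)"
      using assms(1) by (intro mult_right_mono) auto
    ultimately show False
      using nC n by linarith
  qed
  moreover have False if C: "self_identifying_code (circulant_graph n ?D) C"
    and card: "real (card C) = real_of_int n / real r" for C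
  proof -
    have "real_of_int n = real_of_int (int r * int (card C))"
      using card assms(1) by (simp add: field_simps)
    then have nC: "n = int r * int (card C)"
      by (simp only: of_int_eq_iff)
    have sub: "C \<subseteq> {0..<n}" "C \<noteq> {}"
      using C V by (auto simp: self_identifying_code_def is_code_def)
    have "n \<le> 2 * int (card C)"
      using self_identifying_code_small_gaps[OF n D C] nC cardD
      by (intro two_card_ge_if_small_gaps[OF sub]) simp
    \<comment> \<open>Here \<open>r \<ge> 3\<close> still gives \<open>3|C| \<le> n\<close>, which
      again exceeds \<open>2|C|\<close>.\<close>
    moreover have "3 * int (card C) \<le> int r * int (card C)"
      using assms(1) by (intro mult_right_mono) auto
    ultimately show False
      using nC n by linarith
  qed
  ultimately show ?thesis
    by blast
qed

end
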